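(* Let $\delta>0$, let $\varepsilon\in(0,1)$, and let $T:\mathbb{N}\to[0,\infty)$ be any function such that for all $n$, $0\le T(n)\le 1/(2\varepsilon(3+\delta\log_2 n))$. Then for all $n$-vertex graphs $G\in\mathcal{G}_T$, all reset vectors $r$ on $G$, and all $y\in V_G$, we have $\mathrm{cont}_\delta(\mathrm{PR}(G,r,\varepsilon),G,y)\le 1+2\varepsilon T(n)(3+\delta\log_2 n)$.
   Context: Graphs are finite directed graphs; every vertex with no out-edges carries a self-loop. The uniform random walk on $G=(V,E)$ moves from $u$ to a uniformly random out-neighbour of $u$. A ranking (reset) vector is a function $x:V\to[0,1]$ with $\sum_v x[v]=1$. For a reset vector $r$ and $\varepsilon\in(0,1)$, $\mathrm{PR}(G,r,\varepsilon)$ is the unique stationary distribution of the chain which with probability $1-\varepsilon$ takes a uniform random walk step and with probability $\varepsilon$ jumps to a vertex drawn from $r$ (transition matrix $(1-\varepsilon)M+\varepsilon R$, $M[u,v]=1/d_{out}(u)$ for $(u,v)\in E$, $R[u,v]=r[v]$). $\mathcal{G}$ is the set of graphs whose uniform random walk is ergodic, i.e. has a unique stationary distribution $\mathcal{R}(G)$ to which it converges from every initial state. Total variation distance is $d_{TV}(p,q)=\frac12\sum_v|p[v]-q[v]|$. The mixing time is $\tau_G=\min\{t\ge0: \forall v\in V,\ d_{TV}(p_{t,v},\mathcal{R}(G))\le 1/4\}$ where $p_{t,v}$ is the distribution of the uniform random walk at time $t$ from $v$. For $T:\mathbb{N}\to[0,\infty)$, $\mathcal{G}_T=\{G\in\mathcal{G}:\tau_G\le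 T(|V_G|)\}$. For an $n$-vertex $G\in\mathcal{G}$, a ranking vector $x$ and $v\in V$, $\mathrm{cont}_\delta(x,G,v)=\max\{\mathcal{R}(G)[v],n^{-\delta}\}/\max\{x[v],n^{-\delta}\}$. *)

theory Defs
  imports "HOL-Analysis.Analysis" "Graph_Theory.Graph_Theory"
begin

text \<open>A vertex whose only possible out-edge is a self-loop must carry it, so every vertex has
  positive out-degree. Other self-loops are allowed; parallel edges are not.\<close>

definition walk_graph :: "'a pair_pre_digraph \<Rightarrow> bool" where
  "walk_graph G \<longleftrightarrow> pair_fin_digraph G \<and>
     (\<forall>u\<in>pverts G. (\<forall>v. v \<noteq> u \<longrightarrow> (u, v) \<notin> parcs G) \<longrightarrow> (u, u) \<in> parcs G)"

text \<open>Functions from \<open>V\<close> to the unit interval are taken to be extensional, so that uniqueness of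
  a ranking vector is plain equality of functions.\<close>

definition ranking_vectors :: "'a set \<Rightarrow> ('a \<Rightarrow> real) set" where
  "ranking_vectors V = {x \<in> V \<rightarrow>\<^sub>E {0..1}. (\<Sum>v\<in>V. x v) = 1}"

definition walk_matrix :: "'a pair_pre_digraph \<Rightarrow> 'a \<Rightarrow> 'a \<Rightarrow> real" where
  "walk_matrix G u v =
     (if (u, v) \<in> parcs G then 1 / real (out_degree (with_proj G) u) else 0)"

definition stationary :: "'a set \<Rightarrow> ('a \<Rightarrow> 'a \<Rightarrow> real) \<Rightarrow> ('a \<Rightarrow> real) \<Rightarrow> bool" where
  "stationary V P x \<longleftrightarrow>
     x \<in> ranking_vectors V \<and> (\<forall>v\<in>V. (\<Sum>u\<in>V. x u * P u v) = x v)"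

definition pagerank :: "'a pair_pre_digraph \<Rightarrow> ('a \<Rightarrow> real) \<Rightarrow> real \<Rightarrow> 'a \<Rightarrow> real" where
  "pagerank G r \<epsilon> =
     (THE x. stationary (pverts G) (\<lambda>u v. (1 - \<epsilon>) * walk_matrix G u v + \<epsilon> * r v) x)"

primrec walk_dist :: "'a pair_pre_digraph \<Rightarrow> nat \<Rightarrow> 'a \<Rightarrow> 'a \<Rightarrow> real" where
  "walk_dist G 0 u v = (if v = u then 1 else 0)"
| "walk_dist G (Suc t) u v = (\<Sum>w\<in>pverts G. walk_dist G t u w * walk_matrix G w v)"

definition ergodic_walk :: "'a pair_pre_digraph \<Rightarrow> bool" where
  "ergodic_walk G \<longleftrightarrow>
     (\<exists>\<pi>. stationary (pverts G) (walk_matrix G) \<pi> \<and>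
          (\<forall>\<pi>'. stationary (pverts G) (walk_matrix G) \<pi>' \<longrightarrow> \<pi>' = \<pi>) \<and>
          (\<forall>u\<in>pverts G. \<forall>v\<in>pverts G. (\<lambda>t. walk_dist G t u v) \<longlonglongrightarrow> \<pi> v))"

definition ergodic_graphs :: "'a pair_pre_digraph set" where
  "ergodic_graphs = {G. walk_graph G \<and> ergodic_walk G}"

definition walk_stationary :: "'a pair_pre_digraph \<Rightarrow> 'a \<Rightarrow> real" where
  "walk_stationary G = (THE \<pi>. stationary (pverts G) (walk_matrix G) \<pi>)"

definition tv_dist :: "'a set \<Rightarrow> ('a \<Rightarrow> real) \<Rightarrow> ('a \<Rightarrow> real) \<Rightarrow> real" where
  "tv_dist V p q = 1 / 2 * (\<Sum>v\<in>V. \<bar>p v - q v\<bar>)"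

definition mixing_time :: "'a pair_pre_digraph \<Rightarrow> nat" where
  "mixing_time G =
     (LEAST t. \<forall>v\<in>pverts G. tv_dist (pverts G) (walk_dist G t v) (walk_stationary G) \<le> 1 / 4)"

definition graphs_mixing_within :: "(nat \<Rightarrow> real) \<Rightarrow> 'a pair_pre_digraph set" where
  "graphs_mixing_within T =
     {G \<in> ergodic_graphs. real (mixing_time G) \<le> T (card (pverts G))}"

definition cont :: "real \<Rightarrow> ('a \<Rightarrow> real) \<Rightarrow> 'a pair_pre_digraph \<Rightarrow> 'a \<Rightarrow> real" where
  "cont \<delta> x G v =
     max (walk_stationary G v) (real (card (pverts G)) powr (- \<delta>)) /
     max (x v) (real (card (pverts G)) powr (- \<delta>))"

end

theory Submission
  imports Defs
begin

text \<open>Let \<open>M\<close> be the walk matrix, \<open>\<tau>\<close> the mixing time, \<open>\<pi>\<close> the stationary distribution, \<open>x\<close> the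
  PageRank vector, and \<open>D = \<pi> - x\<close>. Every zero-sum vector \<open>f\<close> satisfies
  \<open>\<parallel>f M\<^sup>\<tau>\<parallel>\<^sub>1 \<le> \<parallel>f\<parallel>\<^sub>1 / 2\<close>, because \<open>f M\<^sup>\<tau> = \<Sum>u. f u (p\<^sub>\<tau>\<^sub>,\<^sub>u - \<pi>)\<close>. One step of the walk moves \<open>x\<close> by at
  most \<open>2 \<epsilon>\<close> in this norm, hence \<open>\<parallel>D\<parallel>\<^sub>1 \<le> \<parallel>D\<parallel>\<^sub>1 / 2 + 2 \<epsilon> \<tau>\<close>, i.e. \<open>\<parallel>D\<parallel>\<^sub>1 \<le> 4 \<epsilon> \<tau>\<close>. On the other hand
  \<open>x \<ge> (1 - \<epsilon>)\<^sup>k x M\<^sup>k\<close> pointwise; taking \<open>k = s \<tau>\<close> with \<open>s = \<lceil>\<delta> log\<^sub>2 n\<rceil>\<close> gives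
  \<open>x y \<ge> (1 - \<epsilon> \<tau> s) \<pi> y - 2 \<epsilon> \<tau> / 2\<^sup>s\<close>. When \<open>\<pi> y \<ge> n powr -\<delta> \<ge> 1 / 2\<^sup>s\<close>, this is at least
  \<open>(1 - \<epsilon> \<tau> (s + 2)) \<pi> y\<close>, and \<open>1 / (1 - z) \<le> 1 + 2 z\<close> for \<open>z \<le> 1 / 2\<close>.\<close>

section \<open>Finite stochastic matrices\<close>

definition push :: "'a set \<Rightarrow> ('a \<Rightarrow> 'a \<Rightarrow> real) \<Rightarrow> ('a \<Rightarrow> real) \<Rightarrow> 'a \<Rightarrow> real" where
  "push V P f v = (\<Sum>u\<in>V. f u * P u v)"

definition l1 :: "'a set \<Rightarrow> ('a \<Rightarrow> real) \<Rightarrow> real" where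
  "l1 V f = (\<Sum>v\<in>V. \<bar>f v\<bar>)"

lemma l1_nonneg: "0 \<le> l1 V f"
  by (simp add: l1_def sum_nonneg)

lemma l1_triangle: "l1 V (\<lambda>v. f v + g v) \<le> l1 V f + l1 V g"
  unfolding l1_def sum.distrib[symmetric] by (intro sum_mono abs_triangle_ineq)

lemma l1_scale: "l1 V (\<lambda>v. c * f v) = \<bar>c\<bar> * l1 V f"
  by (simp add: l1_def abs_mult sum_distrib_left)

lemma l1_cong: "(\<And>v. v \<in> V \<Longrightarrow> f v = g v) \<Longrightarrow> l1 V f = l1 V g"
  by (simp add: l1_def)

lemma l1_eq_0D: "finite V \<Longrightarrow> l1 V f = 0 \<Longrightarrow> v \<in> V \<Longrightarrow> f v = 0"
  by (simp add: l1_def sum_nonneg_eq_0_iff)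

text \<open>The entries other than \<open>y\<close> must cancel \<open>f y\<close>, so their
  absolute values add up to at least \<open>f y\<close>.\<close>

lemma zero_sum_le_half_l1:
  assumes "finite V" "(\<Sum>v\<in>V. f v) = 0" "y \<in> V"
  shows "2 * f y \<le> l1 V f"
proof -
  have "f y = - (\<Sum>v\<in>V - {y}. f v)"
    using assms by (simp add: sum.remove)
  moreover have "- (\<Sum>v\<in>V - {y}. f v) \<le> (\<Sum>v\<in>V - {y}. \<bar>f v\<bar>)"
    unfolding sum_negf[symmetric] by (intro sum_mono) simp
  moreover have "l1 V f = \<bar>f y\<bar> + (\<Sum>v\<in>V - {y}. \<bar>f v\<bar>)"
    using assms by (simp add: l1_def sum.remove)
  ultimately show ?thesis by linarith
qed

lemma ranking_vectors_nonneg: "x \<in> ranking_vectors V \<Longrightarrow> v \<in> V \<Longrightarrow> 0 \<le> x v"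
  and ranking_vectors_sum: "x \<in> ranking_vectors V \<Longrightarrow> (\<Sum>v\<in>V. x v) = 1"
  by (auto simp: ranking_vectors_def)

text \<open>Ranking vectors are extensional, hence the \<open>restrict\<close>; the upper bound 1 on
  entries follows from nonnegativity and total mass 1.\<close>

lemma ranking_vectorsI:
  assumes "finite V" "\<And>v. v \<in> V \<Longrightarrow> 0 \<le> x v" "(\<Sum>v\<in>V. x v) = 1"
  shows "restrict x V \<in> ranking_vectors V"
proof -
  have "x v \<le> 1" if "v \<in> V" for v
    using member_le_sum[of v V x] assms that by simp
  then show ?thesis
    using assms by (auto simp: ranking_vectors_def)
qed

lemma ranking_vectors_eqI:
  assumes "x \<in> ranking_vectors V" "x' \<in> ranking_vectors V" "\<And>v. v \<in> V \<Longrightarrow> x v = x' v"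
  shows "x = x'"
  using assms by (auto simp: ranking_vectors_def intro: PiE_ext)

lemma push_cong: "(\<And>u. u \<in> V \<Longrightarrow> f u = g u) \<Longrightarrow> push V P f = push V P g"
  by (simp add: push_def fun_eq_iff)

lemma push_diff: "push V P (\<lambda>v. f v - g v) = (\<lambda>v. push V P f v - push V P g v)"
  by (simp add: push_def fun_eq_iff left_diff_distrib sum_subtractf)

lemma push_scale: "push V P (\<lambda>v. c * f v) = (\<lambda>v. c * push V P f v)"
  by (simp add: push_def fun_eq_iff sum_distrib_left mult.assoc)

lemma push_power_diff:
  "(push V P ^^ t) (\<lambda>v. f v - g v) = (\<lambda>v. (push V P ^^ t) f v - (push V P ^^ t) g v)"
  by (induction t) (simp_all add: push_diff)

locale stochastic_matrix =
  fixes V :: "'a set" and P :: "'a \<Rightarrow> 'a \<Rightarrow> real"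
  assumes finite_V: "finite V"
    and P_nonneg: "u \<in> V \<Longrightarrow> v \<in> V \<Longrightarrow> 0 \<le> P u v"
    and P_row_sum: "u \<in> V \<Longrightarrow> (\<Sum>v\<in>V. P u v) = 1"
begin

lemma sum_push: "(\<Sum>v\<in>V. push V P f v) = (\<Sum>v\<in>V. f v)"
  unfolding push_def
  by (subst sum.swap) (simp add: sum_distrib_left[symmetric] P_row_sum)

lemma push_mono:
  "(\<And>u. u \<in> V \<Longrightarrow> f u \<le> g u) \<Longrightarrow> v \<in> V \<Longrightarrow> push V P f v \<le> push V P g v"
  unfolding push_def by (intro sum_mono mult_right_mono P_nonneg)

lemma push_nonneg: "(\<And>u. u \<in> V \<Longrightarrow> 0 \<le> f u) \<Longrightarrow> v \<in> V \<Longrightarrow> 0 \<le> push V P f v"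
  unfolding push_def by (intro sum_nonneg mult_nonneg_nonneg P_nonneg)

lemma l1_push_le: "l1 V (push V P f) \<le> l1 V f"
proof -
  have "l1 V (push V P f) \<le> (\<Sum>v\<in>V. \<Sum>u\<in>V. \<bar>f u\<bar> * P u v)"
    unfolding l1_def push_def
    by (intro sum_mono order.trans[OF sum_abs]) (simp add: abs_mult P_nonneg)
  also have "\<dots> = l1 V f"
    unfolding l1_def
    by (subst sum.swap) (simp add: sum_distrib_left[symmetric] P_row_sum)
  finally show ?thesis .
qed

lemma sum_push_power: "(\<Sum>v\<in>V. (push V P ^^ t) f v) = (\<Sum>v\<in>V. f v)"
  by (induction t) (simp_all add: sum_push)

lemma push_power_nonneg:
  "(\<And>u. u \<in> V \<Longrightarrow> 0 \<le> f u) \<Longrightarrow> v \<in> V \<Longrightarrow> 0 \<le> (push V P ^^ t) f v"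
  by (induction t arbitrary: v) (auto intro: push_nonneg)

lemma push_power_le_1:
  assumes "\<And>u. u \<in> V \<Longrightarrow> 0 \<le> f u" "(\<Sum>v\<in>V. f v) = 1" "v \<in> V"
  shows "(push V P ^^ t) f v \<le> 1"
  using member_le_sum[of v V "(push V P ^^ t) f"] push_power_nonneg[of f] sum_push_power[of t f]
    finite_V assms by simp

text \<open>Telescoping: t steps move \<open>f\<close> by at most t times what one step does, since
  a stochastic matrix does not expand the norm.\<close>

lemma l1_push_power_diff_le:
  "l1 V (\<lambda>v. (push V P ^^ t) f v - f v) \<le> real t * l1 V (\<lambda>v. push V P f v - f v)"
proof (induction t)
  case 0
  then show ?case by (simp add: l1_def)
next
  case (Suc t)
  let ?g = "(push V P ^^ t) f"
  have "l1 V (\<lambda>v. push V P ?g v - f v)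
      = l1 V (\<lambda>v. (push V P (\<lambda>v. ?g v - f v) v) + (push V P f v - f v))"
    by (simp add: push_diff)
  also have "\<dots> \<le> l1 V (\<lambda>v. ?g v - f v) + l1 V (\<lambda>v. push V P f v - f v)"
    by (intro order.trans[OF l1_triangle] add_right_mono l1_push_le)
  finally show ?case using Suc by (simp add: algebra_simps)
qed

lemma stationary_push_power:
  assumes "stationary V P \<pi>" "v \<in> V"
  shows "(push V P ^^ t) \<pi> v = \<pi> v"
proof -
  have "\<forall>v\<in>V. (push V P ^^ t) \<pi> v = \<pi> v"
  proof (induction t)
    case (Suc t)
    then have "push V P ((push V P ^^ t) \<pi>) = push V P \<pi>"
      by (intro push_cong) simp
    moreover have "push V P \<pi> v = \<pi> v" if "v \<in> V" for v
      using assms(1) that by (simp add: stationary_def push_def)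
    ultimately show ?case by simp
  qed simp
  then show ?thesis using assms by blast
qed

section \<open>The walk with resets\<close>

text \<open>The total mass 1 of \<open>x\<close> turns the averaged jump term into the constant
  vector \<epsilon> r, which makes stationarity an affine fixed-point equation.\<close>

lemma stationary_reset_iff:
  "stationary V (\<lambda>u v. (1 - \<epsilon>) * P u v + \<epsilon> * r v) x \<longleftrightarrow>
     x \<in> ranking_vectors V \<and> (\<forall>v\<in>V. (1 - \<epsilon>) * push V P x v + \<epsilon> * r v = x v)"
proof -
  have "(\<Sum>u\<in>V. x u * ((1 - \<epsilon>) * P u v + \<epsilon> * r v)) = (1 - \<epsilon>) * push V P x v + \<epsilon> * r v"
    if "x \<in> ranking_vectors V" for v
  proof -
    have "(\<Sum>u\<in>V. x u * ((1 - \<epsilon>) * P u v + \<epsilon> * r v))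
        = (1 - \<epsilon>) * push V P x v + (\<Sum>u\<in>V. x u) * (\<epsilon> * r v)"
      by (simp add: push_def sum_distrib_left sum_distrib_right sum.distrib[symmetric] algebra_simps)
    then show ?thesis using that by (simp add: ranking_vectors_sum)
  qed
  then show ?thesis by (auto simp: stationary_def)
qed

text \<open>The witness is the law of the walk started from \<open>r\<close> and stopped after a
  geometrically distributed number of steps, i.e. the Neumann series of the fixed-point
  equation.\<close>

lemma ex_stationary_reset:
  assumes "0 < \<epsilon>" "\<epsilon> < 1" "r \<in> ranking_vectors V"
  shows "\<exists>x. stationary V (\<lambda>u v. (1 - \<epsilon>) * P u v + \<epsilon> * r v) x"
proof -
  define a where "a k v = \<epsilon> * (1 - \<epsilon>) ^ k * (push V P ^^ k) r v" for k v
  define x where "x v = (\<Sum>k. a k v)" for v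
  have geo: "(\<lambda>k. \<epsilon> * (1 - \<epsilon>) ^ k) sums 1"
    using sums_mult[OF geometric_sums[of "1 - \<epsilon>"], of \<epsilon>] assms by simp
  have r: "\<And>u. u \<in> V \<Longrightarrow> 0 \<le> r u" "(\<Sum>v\<in>V. r v) = 1"
    using assms by (simp_all add: ranking_vectors_nonneg ranking_vectors_sum)
  have a_nonneg: "0 \<le> a k v" if "v \<in> V" for k v
    using push_power_nonneg[OF r(1)] that assms by (simp add: a_def)
  have a_le: "a k v \<le> \<epsilon> * (1 - \<epsilon>) ^ k" if "v \<in> V" for k v
    using push_power_le_1[OF r] that assms unfolding a_def by (intro mult_right_le_one_le)
      (auto simp: push_power_nonneg r(1))
  have a_sums: "(\<lambda>k. a k v) sums x v" if "v \<in> V" for v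
    unfolding x_def using a_nonneg[OF that] a_le[OF that]
    by (intro summable_sums summable_comparison_test[OF _ sums_summable[OF geo]]) auto
  have push_a: "(1 - \<epsilon>) * push V P (a k) v = a (Suc k) v" for k v
  proof -
    have "a k = (\<lambda>v. (\<epsilon> * (1 - \<epsilon>) ^ k) * (push V P ^^ k) r v)"
      by (simp add: a_def fun_eq_iff)
    then show ?thesis by (simp add: push_scale a_def algebra_simps)
  qed
  have eq: "(1 - \<epsilon>) * push V P x v + \<epsilon> * r v = x v" if "v \<in> V" for v
  proof -
    \<comment> \<open>Pushing the series termwise shifts its index by one; the missing term
      \<open>a 0\<close> is exactly the reset contribution.\<close>
    have "(\<lambda>k. (1 - \<epsilon>) * push V P (a k) v) sums ((1 - \<epsilon>) * push V P x v)"
      unfolding push_def by (intro sums_mult sums_sum sums_mult2 a_sums)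
    then have "(\<lambda>k. a k v) sums ((1 - \<epsilon>) * push V P x v + a 0 v)"
      unfolding push_a by (rule sums_Suc)
    then show ?thesis
      using sums_unique2[OF a_sums[OF that]] by (simp add: a_def)
  qed
  have "0 \<le> x v" if "v \<in> V" for v
    using a_sums[OF that] a_nonneg[OF that] by (rule sums_le[OF _ sums_zero, rotated])
  moreover have "(\<Sum>v\<in>V. x v) = 1"
  proof -
    have "(\<lambda>k. \<Sum>v\<in>V. a k v) sums (\<Sum>v\<in>V. x v)"
      by (intro sums_sum a_sums)
    moreover have "(\<Sum>v\<in>V. a k v) = \<epsilon> * (1 - \<epsilon>) ^ k" for k
      by (simp add: a_def sum_distrib_left[symmetric] sum_push_power r)
    ultimately show ?thesis using sums_unique2[OF geo] by simp
  qed
  ultimately have "restrict x V \<in> ranking_vectors V"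
    by (intro ranking_vectorsI finite_V)
  \<comment> \<open>\<open>push\<close> reads only the entries on \<open>V\<close>, so making
    \<open>x\<close> extensional keeps the fixed-point equation.\<close>
  moreover have "push V P (restrict x V) = push V P x"
    by (intro push_cong) simp
  ultimately show ?thesis
    unfolding stationary_reset_iff using eq by (intro exI[of _ "restrict x V"]) simp
qed

text \<open>The reset terms cancel in the difference of two solutions, which is thus a fixed point
  of a map shrinking the norm by the factor 1 - \<epsilon>.\<close>

lemma stationary_reset_unique:
  assumes "0 < \<epsilon>" "\<epsilon> < 1"
    and x: "stationary V (\<lambda>u v. (1 - \<epsilon>) * P u v + \<epsilon> * r v) x"
    and x': "stationary V (\<lambda>u v. (1 - \<epsilon>) * P u v + \<epsilon> * r v) x'"
  shows "x = x'"
proof -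
  let ?f = "\<lambda>v. x v - x' v"
  have "l1 V ?f = l1 V (\<lambda>v. (1 - \<epsilon>) * push V P ?f v)"
  proof (intro l1_cong)
    fix v assume "v \<in> V"
    then have "x v = (1 - \<epsilon>) * push V P x v + \<epsilon> * r v"
      "x' v = (1 - \<epsilon>) * push V P x' v + \<epsilon> * r v"
      using x x' by (simp_all add: stationary_reset_iff)
    then show "?f v = (1 - \<epsilon>) * push V P ?f v"
      by (simp add: push_diff right_diff_distrib)
  qed
  also have "\<dots> \<le> (1 - \<epsilon>) * l1 V ?f"
    using assms l1_push_le[of ?f] by (simp add: l1_scale)
  finally have "\<epsilon> * l1 V ?f \<le> 0"
    by (simp add: algebra_simps)
  then have "l1 V ?f = 0"
    using assms l1_nonneg[of V ?f] by (simp add: mult_le_0_iff)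
  then show ?thesis
    using x x' l1_eq_0D[OF finite_V] unfolding stationary_def
    by (intro ranking_vectors_eqI[of x V x']) force+
qed

text \<open>Unrolling the fixed-point equation k times and dropping the nonnegative reset term each
  time keeps only the mass that did not jump in the last k steps.\<close>

lemma reset_power_le:
  assumes "0 < \<epsilon>" "\<epsilon> < 1" "r \<in> ranking_vectors V"
    and x: "stationary V (\<lambda>u v. (1 - \<epsilon>) * P u v + \<epsilon> * r v) x" and "v \<in> V"
  shows "(1 - \<epsilon>) ^ k * (push V P ^^ k) x v \<le> x v"
  using \<open>v \<in> V\<close>
proof (induction k arbitrary: v)
  case (Suc k)
  have "(1 - \<epsilon>) ^ Suc k * (push V P ^^ Suc k) x v
      = (1 - \<epsilon>) * push V P (\<lambda>v. (1 - \<epsilon>) ^ k * (push V P ^^ k) x v) v"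
    by (simp add: push_scale)
  also have "\<dots> \<le> (1 - \<epsilon>) * push V P x v"
    using Suc assms by (intro mult_left_mono push_mono) auto
  also have "\<dots> \<le> (1 - \<epsilon>) * push V P x v + \<epsilon> * r v"
    using assms Suc.prems ranking_vectors_nonneg by fastforce
  also have "\<dots> = x v"
    using x Suc.prems by (simp add: stationary_reset_iff)
  finally show ?case .
qed simp

text \<open>By stationarity, x P - x = \<epsilon> (x P - r), and both vectors in the bracket have
  norm 1.\<close>

lemma reset_step_distance:
  assumes "0 < \<epsilon>" "\<epsilon> < 1" "r \<in> ranking_vectors V"
    and x: "stationary V (\<lambda>u v. (1 - \<epsilon>) * P u v + \<epsilon> * r v) x"
  shows "l1 V (\<lambda>v. push V P x v - x v) \<le> 2 * \<epsilon>"
proof -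
  have xr: "x \<in> ranking_vectors V"
    using x by (simp add: stationary_def)
  have "l1 V (\<lambda>v. push V P x v - x v) = l1 V (\<lambda>v. \<epsilon> * (push V P x v + - 1 * r v))"
  proof (intro l1_cong)
    fix v assume "v \<in> V"
    then have "x v = (1 - \<epsilon>) * push V P x v + \<epsilon> * r v"
      using x by (simp add: stationary_reset_iff)
    then show "push V P x v - x v = \<epsilon> * (push V P x v + - 1 * r v)"
      by (simp add: algebra_simps)
  qed
  also have "\<dots> \<le> \<epsilon> * (l1 V (push V P x) + l1 V r)"
    using assms l1_triangle[of V "push V P x" "\<lambda>v. - 1 * r v"]
    by (simp only: l1_scale) (simp add: l1_scale[of V "- 1", simplified])
  also have "l1 V (push V P x) = 1"
    using xr push_nonneg[of x] sum_push[of x]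
    by (simp add: l1_def ranking_vectors_nonneg ranking_vectors_sum)
  also have "l1 V r = 1"
    using assms by (simp add: l1_def ranking_vectors_nonneg ranking_vectors_sum)
  finally show ?thesis by simp
qed

lemma reset_stationary_lower_bound:
  assumes \<epsilon>: "0 < \<epsilon>" "\<epsilon> < 1" and r: "r \<in> ranking_vectors V"
    and x: "stationary V (\<lambda>u v. (1 - \<epsilon>) * P u v + \<epsilon> * r v) x"
    and \<pi>: "stationary V P \<pi>"
    and contr: "\<And>f. (\<Sum>v\<in>V. f v) = 0 \<Longrightarrow> l1 V ((push V P ^^ t) f) \<le> l1 V f / 2"
    and y: "y \<in> V"
  shows "(1 - real s * real t * \<epsilon>) * \<pi> y - 2 * \<epsilon> * real t / 2 ^ s \<le> x y"
proof -
  let ?D = "\<lambda>v. \<pi> v - x v"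
  have D0: "(\<Sum>v\<in>V. ?D v) = 0"
    using x \<pi> by (simp add: stationary_def sum_subtractf ranking_vectors_sum)
  \<comment> \<open>Since \<pi> is invariant, the pushed difference is \<pi> - x P^t; adding x P^t -
    x restores D.\<close>
  have "l1 V ?D = l1 V (\<lambda>v. (push V P ^^ t) ?D v + ((push V P ^^ t) x v - x v))"
    by (intro l1_cong) (simp add: push_power_diff stationary_push_power[OF \<pi>])
  also have "\<dots> \<le> l1 V ?D / 2 + real t * (2 * \<epsilon>)"
    by (intro order.trans[OF l1_triangle] add_mono contr D0
        order.trans[OF l1_push_power_diff_le] mult_left_mono reset_step_distance[OF \<epsilon> r x]) simp
  finally have D_le: "l1 V ?D \<le> 4 * \<epsilon> * real t" by (simp add: algebra_simps)
  have iter: "l1 V ((push V P ^^ (s * t)) ?D) \<le> l1 V ?D / 2 ^ s"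
  proof (induction s)
    case (Suc s)
    have "l1 V ((push V P ^^ (Suc s * t)) ?D) \<le> l1 V ((push V P ^^ (s * t)) ?D) / 2"
      using contr[of "(push V P ^^ (s * t)) ?D"] sum_push_power[of "s * t" ?D] D0
      by (simp add: funpow_add)
    also have "\<dots> \<le> l1 V ?D / 2 ^ s / 2"
      using Suc by (rule divide_right_mono) simp
    finally show ?case by (simp add: mult.commute)
  qed simp
  let ?k = "s * t"
  have "2 * (push V P ^^ ?k) ?D y \<le> 4 * \<epsilon> * real t / 2 ^ s"
  proof -
    \<comment> \<open>The zero sum saves a factor 2 over bounding the entry by the norm; this is
      where 4 becomes 2 in the error term.\<close>
    have "2 * (push V P ^^ ?k) ?D y \<le> l1 V ((push V P ^^ ?k) ?D)"
      by (intro zero_sum_le_half_l1 finite_V y) (simp add: sum_push_power D0)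
    also note iter
    also have "l1 V ?D / 2 ^ s \<le> 4 * \<epsilon> * real t / 2 ^ s"
      using D_le by (rule divide_right_mono) simp
    finally show ?thesis .
  qed
  then have low: "\<pi> y - 2 * \<epsilon> * real t / 2 ^ s \<le> (push V P ^^ ?k) x y"
    by (simp add: push_power_diff stationary_push_power[OF \<pi> y])
  let ?c = "(1 - \<epsilon>) ^ ?k" and ?b = "2 * \<epsilon> * real t / 2 ^ s"
  have c: "0 \<le> ?c" "?c \<le> 1" "1 - real ?k * \<epsilon> \<le> ?c"
    using \<epsilon> Bernoulli_inequality[of "- \<epsilon>" ?k] by (auto intro: power_le_one)
  have "0 \<le> \<pi> y"
    using \<pi> y by (auto simp: stationary_def intro: ranking_vectors_nonneg)
  \<comment> \<open>Bernoulli bounds the survival factor \<open>?c\<close> from below at \<pi>,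
    while \<open>?c\<close> at most 1 only shrinks the subtracted error.\<close>
  then have "(1 - real ?k * \<epsilon>) * \<pi> y - ?b \<le> ?c * \<pi> y - ?c * ?b"
    using c \<epsilon> by (intro diff_mono mult_right_mono mult_left_le_one_le) auto
  also have "\<dots> \<le> ?c * (push V P ^^ ?k) x y"
    using mult_left_mono[OF low c(1)] by (simp add: right_diff_distrib)
  also have "\<dots> \<le> x y"
    by (rule reset_power_le[OF \<epsilon> r x y])
  finally show ?thesis by simp
qed

end

section \<open>The uniform random walk\<close>

lemma walk_matrix_stochastic:
  assumes "walk_graph G"
  shows "stochastic_matrix (pverts G) (walk_matrix G)"
proof
  interpret pair_fin_digraph G
    using assms by (simp add: walk_graph_def)
  show "finite (pverts G)" by simp
  show "0 \<le> walk_matrix G u v" for u v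
    by (simp add: walk_matrix_def)
  fix u assume u: "u \<in> pverts G"
  define N where "N = {v \<in> pverts G. (u, v) \<in> parcs G}"
  have "out_arcs (with_proj G) u = Pair u ` N"
    using in_arcsD2 by (auto simp: N_def out_arcs_def)
  then have deg: "out_degree (with_proj G) u = card N"
    by (simp add: out_degree_def card_image inj_on_def)
  have "finite N" by (simp add: N_def)
  moreover have "N \<noteq> {}"
  proof -
    \<comment> \<open>Either \<open>u\<close> has an arc to another vertex, or the self-loop
      condition supplies one.\<close>
    obtain v where "(u, v) \<in> parcs G"
      using assms u unfolding walk_graph_def by blast
    then show ?thesis using in_arcsD2 by (auto simp: N_def)
  qed
  ultimately have "card N \<noteq> 0" by simp
  moreover have "(\<Sum>v\<in>pverts G. walk_matrix G u v) = (\<Sum>v\<in>N. 1 / real (card N))"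
    unfolding N_def[symmetric] walk_matrix_def deg
    by (simp add: N_def sum.inter_filter[symmetric])
  ultimately show "(\<Sum>v\<in>pverts G. walk_matrix G u v) = 1" by simp
qed

section \<open>Mixing of the uniform walk in the 1-norm\<close>

lemma push_power_walk_matrix:
  assumes "finite (pverts G)" "v \<in> pverts G"
  shows "(push (pverts G) (walk_matrix G) ^^ t) f v = (\<Sum>u\<in>pverts G. f u * walk_dist G t u v)"
  using \<open>v \<in> pverts G\<close>
proof (induction t arbitrary: v)
  case 0
  then show ?case using assms by (simp add: if_distrib cong: if_cong)
next
  case (Suc t)
  let ?V = "pverts G"
  have "(push ?V (walk_matrix G) ^^ Suc t) f v
      = (\<Sum>w\<in>?V. (\<Sum>u\<in>?V. f u * walk_dist G t u w) * walk_matrix G w v)"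
    using Suc.IH by (simp add: push_def[of _ _ "(push _ _ ^^ t) f"])
  also have "\<dots> = (\<Sum>u\<in>?V. \<Sum>w\<in>?V. f u * walk_dist G t u w * walk_matrix G w v)"
    by (simp add: sum_distrib_right) (rule sum.swap)
  also have "\<dots> = (\<Sum>u\<in>?V. f u * walk_dist G (Suc t) u v)"
    by (simp add: sum_distrib_left mult.assoc)
  finally show ?case .
qed

lemma walk_stationary_stationary:
  assumes "ergodic_walk G"
  shows "stationary (pverts G) (walk_matrix G) (walk_stationary G)"
  using assms unfolding ergodic_walk_def walk_stationary_def by (metis theI)

text \<open>The \<open>LEAST\<close> in \<open>mixing_time\<close> has the defining property only if
  some t qualifies. Convergence from each start, made uniform over the finitely many vertices,
  supplies one.\<close>

lemma tv_dist_mixing_time_le: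
  assumes "finite (pverts G)" "ergodic_walk G" "u \<in> pverts G"
  shows "tv_dist (pverts G) (walk_dist G (mixing_time G) u) (walk_stationary G) \<le> 1 / 4"
proof -
  let ?V = "pverts G" and ?\<pi> = "walk_stationary G"
  have lim: "(\<lambda>t. walk_dist G t u v) \<longlonglongrightarrow> ?\<pi> v" if "u \<in> ?V" "v \<in> ?V" for u v
    using assms(2) that walk_stationary_stationary[OF assms(2)] unfolding ergodic_walk_def by metis
  have "(\<lambda>t. tv_dist ?V (walk_dist G t u) ?\<pi>) \<longlonglongrightarrow> 1 / 2 * (\<Sum>v\<in>?V. \<bar>?\<pi> v - ?\<pi> v\<bar>)"
    if "u \<in> ?V" for u
    unfolding tv_dist_def using lim[OF that] by (intro tendsto_intros)
  then have "\<forall>\<^sub>F t in sequentially. tv_dist ?V (walk_dist G t u) ?\<pi> < 1 / 4" if "u \<in> ?V" for u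
    using that by (intro order_tendstoD(2)) auto
  then have "\<forall>\<^sub>F t in sequentially. \<forall>u\<in>?V. tv_dist ?V (walk_dist G t u) ?\<pi> < 1 / 4"
    using assms(1) by (simp add: eventually_ball_finite)
  then obtain t where "\<forall>u\<in>?V. tv_dist ?V (walk_dist G t u) ?\<pi> \<le> 1 / 4"
    unfolding eventually_sequentially by (meson less_imp_le order_refl)
  then have "\<forall>u\<in>?V. tv_dist ?V (walk_dist G (mixing_time G) u) ?\<pi> \<le> 1 / 4"
    unfolding mixing_time_def by (rule LeastI)
  then show ?thesis using assms(3) by blast
qed

text \<open>The zero sum of \<open>f\<close> allows \<pi> to be subtracted from every row of the
  t-step matrix. Each row then has norm at most 1/2, twice the total variation threshold
  1/4.\<close>

lemma l1_push_mixing_time_le: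
  assumes "finite (pverts G)" "ergodic_walk G" "(\<Sum>v\<in>pverts G. f v) = 0"
  shows "l1 (pverts G) ((push (pverts G) (walk_matrix G) ^^ mixing_time G) f) \<le> l1 (pverts G) f / 2"
proof -
  let ?V = "pverts G" and ?\<pi> = "walk_stationary G" and ?p = "walk_dist G (mixing_time G)"
  have "l1 ?V ((push ?V (walk_matrix G) ^^ mixing_time G) f)
      = (\<Sum>v\<in>?V. \<bar>\<Sum>u\<in>?V. f u * (?p u v - ?\<pi> v)\<bar>)"
    unfolding l1_def using assms
    by (intro sum.cong refl arg_cong[of _ _ abs])
      (simp add: push_power_walk_matrix right_diff_distrib sum_subtractf sum_distrib_right[symmetric])
  also have "\<dots> \<le> (\<Sum>v\<in>?V. \<Sum>u\<in>?V. \<bar>f u\<bar> * \<bar>?p u v - ?\<pi> v\<bar>)"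
    by (intro sum_mono order.trans[OF sum_abs]) (simp add: abs_mult)
  also have "\<dots> = (\<Sum>u\<in>?V. \<bar>f u\<bar> * (\<Sum>v\<in>?V. \<bar>?p u v - ?\<pi> v\<bar>))"
    by (subst sum.swap) (simp add: sum_distrib_left)
  also have "\<dots> \<le> (\<Sum>u\<in>?V. \<bar>f u\<bar> * (1 / 2))"
    using tv_dist_mixing_time_le[OF assms(1,2)]
    by (intro sum_mono mult_left_mono) (auto simp: tv_dist_def mult.commute)
  finally show ?thesis by (simp add: l1_def sum_divide_distrib)
qed

section \<open>PageRank of an ergodic graph and the ratio bound\<close>

lemma pagerank_stationary:
  assumes "walk_graph G" "0 < \<epsilon>" "\<epsilon> < 1" "r \<in> ranking_vectors (pverts G)"
  shows "stationary (pverts G) (\<lambda>u v. (1 - \<epsilon>) * walk_matrix G u v + \<epsilon> * r v) (pagerank G r \<epsilon>)"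
proof -
  interpret stochastic_matrix "pverts G" "walk_matrix G"
    using assms by (intro walk_matrix_stochastic)
  show ?thesis
    unfolding pagerank_def
    using ex_stationary_reset[OF assms(2-4)] stationary_reset_unique[OF assms(2,3)]
    by (metis (no_types, lifting) theI)
qed

lemma pagerank_lower_bound:
  assumes "walk_graph G" "ergodic_walk G" "0 < \<epsilon>" "\<epsilon> < 1" "r \<in> ranking_vectors (pverts G)"
    and "y \<in> pverts G"
  shows "(1 - real s * real (mixing_time G) * \<epsilon>) * walk_stationary G y
      - 2 * \<epsilon> * real (mixing_time G) / 2 ^ s \<le> pagerank G r \<epsilon> y"
proof -
  interpret stochastic_matrix "pverts G" "walk_matrix G"
    using assms by (intro walk_matrix_stochastic)
  show ?thesis
    using assms
    by (intro reset_stationary_lower_bound[OF _ _ _ pagerank_stationary]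
        walk_stationary_stationary l1_push_mixing_time_le finite_V) auto
qed

theorem theorem9:
  fixes \<delta> \<epsilon> :: real and T :: "nat \<Rightarrow> real"
    and G :: "'a pair_pre_digraph" and r :: "'a \<Rightarrow> real" and n :: nat and y :: 'a
  assumes "\<delta> > 0" and "0 < \<epsilon>" and "\<epsilon> < 1"
    and "\<And>m. 0 \<le> T m"
    and "\<And>m. m \<ge> 1 \<Longrightarrow> T m \<le> 1 / (2 * \<epsilon> * (3 + \<delta> * log 2 (real m)))"
    and "G \<in> graphs_mixing_within T" and "card (pverts G) = n"
    and "r \<in> ranking_vectors (pverts G)"
    and "y \<in> pverts G"
  shows "cont \<delta> (pagerank G r \<epsilon>) G y \<le> 1 + 2 * \<epsilon> * T n * (3 + \<delta> * log 2 (real n))"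
proof -
  have G: "walk_graph G" "ergodic_walk G" and \<tau>: "real (mixing_time G) \<le> T n"
    using assms(6,7) by (auto simp: graphs_mixing_within_def ergodic_graphs_def)
  interpret stochastic_matrix "pverts G" "walk_matrix G"
    by (rule walk_matrix_stochastic[OF G(1)])
  have n: "n \<ge> 1"
    using assms(7,9) finite_V by (auto simp: Suc_le_eq card_gt_0_iff)
  define L where "L = 3 + \<delta> * log 2 (real n)"
  define z where "z = \<epsilon> * T n * L"
  define a where "a = real n powr - \<delta>"
  \<comment> \<open>Rounding up makes 1 / 2^s at most \<open>a\<close> and costs less than 1, so
    that s + 2 stays below the 3 + \<delta> log n of the bound.\<close>
  define s where "s = nat \<lceil>\<delta> * log 2 (real n)\<rceil>"
  let ?\<pi> = "walk_stationary G y" and ?x = "pagerank G r \<epsilon> y"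
  have log_nonneg: "0 \<le> \<delta> * log 2 (real n)"
    using n assms(1) by simp
  then have L: "L \<ge> 3" by (simp add: L_def)
  have z: "0 \<le> z" "z \<le> 1 / 2"
    using assms(2,4) assms(5)[OF n] L by (simp_all add: z_def L_def[symmetric] field_simps)
  have a: "a > 0" using n by (simp add: a_def)
  have s: "\<delta> * log 2 (real n) \<le> real s" "real s + 2 \<le> L"
    using log_nonneg by (simp_all add: s_def L_def) linarith+
  have "1 / 2 ^ s = 2 powr - real s"
    by (simp add: powr_minus powr_realpow divide_inverse)
  also have "\<dots> \<le> 2 powr (log 2 (real n) * - \<delta>)"
    using s(1) by (intro powr_mono) (auto simp: mult.commute)
  also have "\<dots> = a"
    using n unfolding a_def by (subst powr_powr[symmetric]) simp
  finally have s_a: "1 / 2 ^ s \<le> a" .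
  have "max ?\<pi> a \<le> (1 + 2 * z) * max ?x a"
  \<comment> \<open>Below the cutoff \<open>a\<close> the ratio is at most 1; only above it is the
    lower bound on PageRank needed.\<close>
  proof (cases "?\<pi> \<le> a")
    case True
    have "max ?\<pi> a \<le> max ?x a" using True by simp
    also have "\<dots> \<le> (1 + 2 * z) * max ?x a"
      using z a mult_right_mono[of 1 "1 + 2 * z" "max ?x a"] by (simp add: less_max_iff_disj)
    finally show ?thesis .
  next
    case False
    have p: "0 < ?\<pi>" "1 / 2 ^ s \<le> ?\<pi>" using False a s_a by linarith+
    have "real (mixing_time G) * (real s + 2) \<le> T n * L"
      using \<tau> s(2) assms(4) L by (intro mult_mono) auto
    then have e: "\<epsilon> * real (mixing_time G) * (real s + 2) \<le> z"
      using assms(2) by (simp add: z_def mult.assoc)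
    have "(1 - z) * ?\<pi> \<le> (1 - \<epsilon> * real (mixing_time G) * (real s + 2)) * ?\<pi>"
      using e p by (intro mult_right_mono) auto
    also have "\<dots> = (1 - real s * real (mixing_time G) * \<epsilon>) * ?\<pi>
        - 2 * \<epsilon> * real (mixing_time G) * ?\<pi>"
      by (simp add: algebra_simps)
    \<comment> \<open>Above the cutoff, 1 / 2^s is at most \<pi>, so the additive error is absorbed
      into a multiplicative one.\<close>
    also have "\<dots> \<le> (1 - real s * real (mixing_time G) * \<epsilon>) * ?\<pi>
        - 2 * \<epsilon> * real (mixing_time G) * (1 / 2 ^ s)"
      using p assms(2) by (intro diff_left_mono mult_left_mono) auto
    also have "\<dots> \<le> ?x"
      using pagerank_lower_bound[OF G assms(2,3,8,9), of s] by simp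
    finally have x: "(1 - z) * ?\<pi> \<le> ?x" .
    \<comment> \<open>The product exceeds 1 by z (1 - 2 z), nonnegative because the hypothesis on
      \<open>T\<close> gives z at most 1/2.\<close>
    have "1 \<le> (1 + 2 * z) * (1 - z)"
      using mult_nonneg_nonneg[of z "1 - 2 * z"] z by (simp add: algebra_simps)
    then have "?\<pi> \<le> (1 + 2 * z) * (1 - z) * ?\<pi>"
      using mult_right_mono[of 1 _ ?\<pi>] p by simp
    also have "\<dots> \<le> (1 + 2 * z) * max ?x a"
      using x z by (simp only: mult.assoc, intro mult_left_mono) auto
    finally show ?thesis using False by simp
  qed
  then have "max ?\<pi> a / max ?x a \<le> 1 + 2 * z"
    using a by (simp add: pos_divide_le_eq less_max_iff_disj)
  then show ?thesis
    by (simp add: cont_def assms(7) a_def z_def L_def mult.assoc)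
qed

end
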